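(* Let $f(t)$ be a formal power series in $t$ with $f(0)=1$ (with coefficients in a commutative ring not involving the $x_i$). Let $\alpha_1,\dots,\alpha_n\ge1$ be integers, $m=\sum_i\alpha_i$, and for an integer $\alpha\ge 1$ and a variable $x$ let $M(\alpha,m,x)$ be the $\alpha\times m$ matrix with entries $$M(\alpha,m,x)_{i,j}:=[t^{j-i}]\frac{f(t)}{(1-tx)^i},\qquad i\in[\alpha],\ j\in[m].$$ Then $$\det\begin{pmatrix}M(\alpha_1,m,x_1)\\ \vdots\\ M(\alpha_n,m,x_n)\end{pmatrix}=\prod_{1\le i<j\le n}(x_j-x_i)^{\alpha_i\alpha_j}.$$
   Context: $[t^k]g(t)$ denotes the coefficient of $t^k$ in the formal power series $g(t)$, which is $0$ for $k<0$. The matrix in the determinant is the $m\times m$ matrix obtained by stacking the blocks vertically; $x_1,\dots,x_n$ are indeterminates. *)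

theory Defs
  imports
    "HOL-Library.Poly_Mapping"
    "HOL-Computational_Algebra.Formal_Power_Series"
    "Jordan_Normal_Form.Determinant"
begin

text \<open>Polynomials with coefficients in \<open>'a\<close> in indeterminates \<open>x\<^sub>0, x\<^sub>1, x\<^sub>2, \<dots>\<close>, as finitely
  supported functions on exponent vectors with the convolution product.\<close>

type_synonym 'a mpoly = "(nat \<Rightarrow>\<^sub>0 nat) \<Rightarrow>\<^sub>0 'a"

definition indet :: "nat \<Rightarrow> 'a::comm_ring_1 mpoly"
  where "indet i = Poly_Mapping.single (Poly_Mapping.single i 1) 1"

definition mconst :: "'a::comm_ring_1 \<Rightarrow> 'a mpoly"
  where "mconst c = Poly_Mapping.single 0 c"

definition mconst_fps :: "'a::comm_ring_1 fps \<Rightarrow> 'a mpoly fps"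
  where "mconst_fps f = Abs_fps (\<lambda>k. mconst (fps_nth f k))"

definition fps_coeff_int :: "'b::zero fps \<Rightarrow> int \<Rightarrow> 'b"
  where "fps_coeff_int g k = (if k < 0 then 0 else fps_nth g (nat k))"

text \<open>The quotient \<open>F / G\<close> for \<open>G\<close> with constant term 1. The operation \<open>/\<close> on \<open>fps\<close> needs an
  \<open>inverse\<close> on the coefficients, which a general commutative ring does not have.\<close>

definition fps_quot :: "'b::comm_ring_1 fps \<Rightarrow> 'b fps \<Rightarrow> 'b fps"
  where "fps_quot F G = F * fps_right_inverse G 1"

lemma fps_quot_unique:
  fixes F G Q :: "'b::comm_ring_1 fps"
  assumes "fps_nth G 0 = 1"
  shows "Q = fps_quot F G \<longleftrightarrow> G * Q = F"
proof -
  have inv: "G * fps_right_inverse G 1 = 1"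
    using assms by (intro fps_right_inverse) simp
  have "Q = F * fps_right_inverse G 1" if "G * Q = F"
    using that inv by (metis mult.assoc mult.commute mult_1)
  moreover have "G * (F * fps_right_inverse G 1) = F"
    using inv by (metis mult.assoc mult.commute mult_1)
  ultimately show ?thesis
    unfolding fps_quot_def by blast
qed

text \<open>Matrix indices start at 0, so the entry at \<open>(a, b)\<close> is the one for \<open>i = a + 1\<close>,
  \<open>j = b + 1\<close>.\<close>

definition M_block :: "'b::comm_ring_1 fps \<Rightarrow> nat \<Rightarrow> nat \<Rightarrow> 'b \<Rightarrow> 'b mat"
  where "M_block F \<alpha> m x = mat \<alpha> m (\<lambda>(a, b).
    let i = a + 1; j = b + 1
    in fps_coeff_int (fps_quot F ((1 - fps_X * fps_const x) ^ i)) (int j - int i))"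

definition stack_rows :: "nat \<Rightarrow> 'b::zero mat list \<Rightarrow> 'b mat"
  where "stack_rows m As = foldr append_rows As (0\<^sub>m 0 m)"

lemma stack_rows_carrier:
  assumes "\<forall>A\<in>set As. dim_col A = m"
  shows "stack_rows m As \<in> carrier_mat (\<Sum>A\<leftarrow>As. dim_row A) m"
  using assms unfolding stack_rows_def
  by (induction As) (auto intro!: carrier_append_rows)

end

theory Submission
  imports Defs
begin

text \<open>
  The row \<open>(k, a)\<close> lists the coefficients of \<open>f(t) t\<^sup>a / (1 - t x\<^sub>k)\<^sup>a\<^sup>+\<^sup>1\<close>, so the matrix factors as
  \<open>V T\<close>, where \<open>T\<close> is the unitriangular Toeplitz matrix of \<open>f\<close> and \<open>V\<close> is the confluent Vandermonde
  matrix whose row \<open>(k, a)\<close> sends a polynomial \<open>p\<close> to the \<open>a\<close>-th coefficient of \<open>p(x\<^sub>k + y)\<close> in \<open>y\<close>.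
  Multiplying \<open>V\<close> by the unitriangular matrix of the Newton basis
  \<open>(y - z\<^sub>0) \<cdots> (y - z\<^sub>r\<^sub>-\<^sub>1)\<close>, where \<open>z\<^sub>s\<close> is the node of row \<open>s\<close>, gives a lower triangular matrix
  whose diagonal entries are the products of the differences of \<open>z\<^sub>r\<close> with the earlier distinct
  nodes. The argument is free of division and works over every commutative ring.
\<close>

section \<open>Confluent Vandermonde determinants\<close>

definition newton_poly :: "('k \<Rightarrow> 'b::comm_ring_1) \<Rightarrow> 'k list \<Rightarrow> 'b poly"
  where "newton_poly x ls = (\<Prod>k\<leftarrow>ls. [:- x k, 1:])"

lemma degree_newton_poly_le: "degree (newton_poly x ls) \<le> length ls"
proof (induction ls)
  case (Cons k ls)
  have "degree (newton_poly x (k # ls)) \<le> degree [:- x k, 1:] + degree (newton_poly x ls)"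
    unfolding newton_poly_def list.map prod_list.Cons by (rule degree_mult_le)
  with Cons show ?case by simp
qed (simp add: newton_poly_def)

lemma coeff_newton_poly_length: "coeff (newton_poly x ls) (length ls) = 1"
proof (induction ls)
  case (Cons k ls)
  have "coeff (newton_poly x ls) (Suc (length ls)) = 0"
    using degree_newton_poly_le[of x ls] by (intro coeff_eq_0) simp
  with Cons show ?case by (simp add: newton_poly_def)
qed (simp add: newton_poly_def)

lemma pcompose_newton_poly:
  "pcompose (newton_poly x ls) [:y, 1:] = (\<Prod>k\<leftarrow>ls. [:y - x k, 1:])"
  by (induction ls)
    (simp_all add: newton_poly_def pcompose_1 pcompose_mult pcompose_pCons del: mult_pCons_left)

text \<open>A factor with label \<open>l\<close> is the bare variable y, so the product is y to the
  number of such factors times the rest, and the rest has the product of differences as its constant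
  term.\<close>

lemma coeff_shifted_newton_poly:
  fixes x :: "'k \<Rightarrow> 'b::comm_ring_1"
  shows "(\<forall>a < count_list ls l. coeff (\<Prod>k\<leftarrow>ls. [:x l - x k, 1:]) a = 0) \<and>
    coeff (\<Prod>k\<leftarrow>ls. [:x l - x k, 1:]) (count_list ls l) =
      (\<Prod>k\<leftarrow>filter (\<lambda>k. k \<noteq> l) ls. x l - x k)"
proof (induction ls)
  case (Cons k ls)
  then show ?case
    by (auto simp: coeff_pCons split: nat.split)
qed simp

text \<open>Both sides are linear in \<open>p\<close>, so monomials suffice. Summing up to
  \<open>m\<close> instead of the degree lets the sum be read as a row of the matrix times a column
  of coefficients.\<close>

lemma coeff_pcompose_linear:
  fixes p :: "'b::comm_ring_1 poly"
  assumes "degree p < m"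
  shows "coeff (pcompose p [:x, 1:]) a = (\<Sum>b<m. coeff ([:x, 1:] ^ b) a * coeff p b)"
proof -
  have "p = (\<Sum>b<m. smult (coeff p b) (monom 1 b))"
    using assms poly_as_sum_of_monoms'[of p "m - 1"]
    by (cases m) (simp_all add: smult_monom lessThan_Suc_atMost)
  moreover have "pcompose (monom 1 b) [:x, 1:] = [:x, 1:] ^ b" for b
    by (induction b) (simp_all add: pcompose_1 pcompose_pCons monom_Suc del: mult_pCons_left flip: one_pCons)
  ultimately have "pcompose p [:x, 1:] = (\<Sum>b<m. smult (coeff p b) ([:x, 1:] ^ b))"
    by (metis (no_types, lifting) pcompose_smult pcompose_sum sum.cong)
  then show ?thesis by (simp add: coeff_sum mult.commute)
qed

text \<open>The entries of a row with node \<open>x\<close> are the binomial multiples \<open>(b choose a) x\<^sup>b\<^sup>-\<^sup>a\<close>, written as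
  coefficients of \<open>(x + y)\<^sup>b\<close>. The list of labels may be in any order: the \<open>r\<close>-th row takes the
  coefficient of \<open>y\<^sup>a\<close>, where \<open>a\<close> counts the earlier occurrences of its label.\<close>

definition confluent_vandermonde :: "('k \<Rightarrow> 'b::comm_ring_1) \<Rightarrow> 'k list \<Rightarrow> 'b mat"
  where "confluent_vandermonde x ls = mat (length ls) (length ls)
    (\<lambda>(r, b). coeff ([:x (ls ! r), 1:] ^ b) (count_list (take r ls) (ls ! r)))"

text \<open>Filtering by label, not by value, keeps the formula valid when distinct labels have
  equal nodes.\<close>

definition node_differences :: "('k \<Rightarrow> 'b::comm_ring_1) \<Rightarrow> 'k list \<Rightarrow> 'b"
  where "node_differences x ls =
    (\<Prod>r<length ls. \<Prod>k\<leftarrow>filter (\<lambda>k. k \<noteq> ls ! r) (take r ls). x (ls ! r) - x k)"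

lemma det_upper_unitriangular:
  fixes A :: "'b::comm_ring_1 mat"
  assumes "A \<in> carrier_mat m m"
    and "\<And>i j. j < i \<Longrightarrow> i < m \<Longrightarrow> A $$ (i, j) = 0"
    and "\<And>i. i < m \<Longrightarrow> A $$ (i, i) = 1"
  shows "det A = 1"
proof -
  have "det A = prod_list (diag_mat A)"
    using assms by (intro det_upper_triangular) auto
  also have "\<dots> = 1"
    using assms by (simp add: prod_list_diag_prod)
  finally show ?thesis .
qed

theorem det_confluent_vandermonde:
  fixes x :: "'k \<Rightarrow> 'b::comm_ring_1"
  shows "det (confluent_vandermonde x ls) = node_differences x ls"
proof -
  define m where "m = length ls"
  define V where "V = confluent_vandermonde x ls"
  define P where "P = mat m m (\<lambda>(b, s). coeff (newton_poly x (take s ls)) b)"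
  have V: "V \<in> carrier_mat m m" and P: "P \<in> carrier_mat m m"
    by (simp_all add: V_def P_def m_def confluent_vandermonde_def)
  have deg: "degree (newton_poly x (take s ls)) \<le> s" for s
    using degree_newton_poly_le[of x "take s ls"] by simp
  have "det P = 1"
  proof (rule det_upper_unitriangular[OF P])
    show "P $$ (b, s) = 0" if "s < b" "b < m" for b s
      using that deg[of s] by (simp add: P_def coeff_eq_0)
    show "P $$ (s, s) = 1" if "s < m" for s
      using that coeff_newton_poly_length[of x "take s ls"] by (simp add: P_def m_def)
  qed
  have VP: "(V * P) $$ (r, s) = coeff (\<Prod>k\<leftarrow>take s ls. [:x (ls ! r) - x k, 1:])
      (count_list (take r ls) (ls ! r))" if "r < m" "s < m" for r s
  proof -
    have "(V * P) $$ (r, s) = (\<Sum>b<m. coeff ([:x (ls ! r), 1:] ^ b) (count_list (take r ls) (ls ! r))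
        * coeff (newton_poly x (take s ls)) b)"
      using that V P
      by (simp add: scalar_prod_def lessThan_atLeast0)
         (simp add: V_def P_def confluent_vandermonde_def m_def)
    also have "\<dots> = coeff (pcompose (newton_poly x (take s ls)) [:x (ls ! r), 1:])
        (count_list (take r ls) (ls ! r))"
      using deg[of s] that by (intro coeff_pcompose_linear[symmetric]) simp
    finally show ?thesis by (simp add: pcompose_newton_poly)
  qed
  have "det V = det (V * P)"
    using det_mult[OF V P] \<open>det P = 1\<close> by simp
  also have "\<dots> = prod_list (diag_mat (V * P))"
  proof (rule det_lower_triangular)
    show "(V * P) $$ (r, s) = 0" if "r < s" "s < m" for r s
    proof -
      \<comment> \<open>Position \<open>r\<close> itself adds an occurrence of its label, so y
        divides the shifted polynomial to a higher power than the one whose coefficient row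
        \<open>r\<close> extracts.\<close>
      have "take s ls = take r ls @ ls ! r # take (s - Suc r) (drop (Suc r) ls)"
        using that id_take_nth_drop[of r "take s ls"] by (simp add: m_def drop_take min_def)
      then have "count_list (take r ls) (ls ! r) < count_list (take s ls) (ls ! r)"
        by simp
      then show ?thesis
        using that VP coeff_shifted_newton_poly[of "take s ls" "ls ! r" x] by simp
    qed
  qed (use V P in auto)
  also have "\<dots> = (\<Prod>r<m. (V * P) $$ (r, r))"
    using V P by (simp add: prod_list_diag_prod lessThan_atLeast0)
  also have "\<dots> = node_differences x ls"
    unfolding node_differences_def m_def[symmetric]
    using VP coeff_shifted_newton_poly[of "take _ ls" _ x] by (intro prod.cong) auto
  finally show ?thesis unfolding V_def .
qed

section \<open>Stacked blocks\<close>

definition block_labels :: "('k \<Rightarrow> nat) \<Rightarrow> 'k list \<Rightarrow> 'k list"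
  where "block_labels \<alpha> ks = concat (map (\<lambda>k. replicate (\<alpha> k) k) ks)"

lemma length_block_labels: "length (block_labels \<alpha> ks) = (\<Sum>k\<leftarrow>ks. \<alpha> k)"
  by (induction ks) (simp_all add: block_labels_def)

lemma set_block_labels: "set (block_labels \<alpha> ks) \<subseteq> set ks"
  by (auto simp: block_labels_def)

lemma count_list_replicate: "count_list (replicate n k) l = (if k = l then n else 0)"
  by (induction n) auto

lemma count_list_block_labels_le:
  assumes "distinct ks"
  shows "count_list (block_labels \<alpha> ks) l \<le> \<alpha> l"
  using assms
proof (induction ks)
  case (Cons k ks)
  moreover have "count_list (block_labels \<alpha> ks) k = 0"
    using Cons.prems set_block_labels[of \<alpha> ks] by (auto simp: count_list_0_iff)
  ultimately show ?case
    by (auto simp: block_labels_def count_list_replicate)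
qed (simp add: block_labels_def)

text \<open>As each label owns a single block, the number of its earlier occurrences is the local
  row index in that block.\<close>

lemma stack_rows_index:
  assumes "distinct ks" and "\<And>k. B k \<in> carrier_mat (\<alpha> k) m"
  defines "ls \<equiv> block_labels \<alpha> ks"
  shows "stack_rows m (map B ks) =
    mat (length ls) m (\<lambda>(r, b). B (ls ! r) $$ (count_list (take r ls) (ls ! r), b))"
  using assms(1) unfolding ls_def
proof (induction ks)
  case Nil
  show ?case by (intro eq_matI) (auto simp: stack_rows_def block_labels_def)
next
  case (Cons k ks)
  define ls where "ls = block_labels \<alpha> ks"
  have ls: "block_labels \<alpha> (k # ks) = replicate (\<alpha> k) k @ ls"
    by (simp add: block_labels_def ls_def)
  have IH: "stack_rows m (map B ks) =
      mat (length ls) m (\<lambda>(r, b). B (ls ! r) $$ (count_list (take r ls) (ls ! r), b))"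
    using Cons by (simp add: ls_def)
  have neq: "k \<noteq> ls ! r" if "r < length ls" for r
  proof -
    have "ls ! r \<in> set ks"
      using set_block_labels[of \<alpha> ks] nth_mem[OF that] unfolding ls_def by blast
    with Cons.prems show ?thesis by auto
  qed
  have dims: "dim_row (B k) = \<alpha> k" "dim_col (B k) = m"
    using assms(2)[of k] by auto
  have "stack_rows m (map B (k # ks)) = B k @\<^sub>r stack_rows m (map B ks)"
    by (simp add: stack_rows_def)
  then show ?case
    unfolding ls IH append_rows_def
    by (intro eq_matI)
      (auto simp: dims nth_append count_list_replicate neq min_def)
qed

text \<open>Earlier copies of \<open>l\<close> are filtered out, so all \<open>c\<close> new rows
  contribute the same factor.\<close>

lemma node_differences_append_replicate:
  assumes "l \<notin> set ls"
  shows "node_differences x (ls @ replicate c l) =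
    node_differences x ls * (\<Prod>k\<leftarrow>ls. x l - x k) ^ c"
proof (induction c)
  case (Suc c)
  define ls' where "ls' = ls @ replicate c l"
  have "filter (\<lambda>k. k \<noteq> l) ls' = ls"
    using assms by (simp add: ls'_def filter_id_conv) metis
  moreover have "node_differences x (ls' @ [l]) =
      node_differences x ls' * (\<Prod>k\<leftarrow>filter (\<lambda>k. k \<noteq> l) ls'. x l - x k)"
    by (simp add: node_differences_def nth_append)
  moreover have "ls @ replicate (Suc c) l = ls' @ [l]"
    by (simp add: ls'_def replicate_append_same)
  ultimately show ?case
    using Suc by (simp add: ls'_def mult_ac)
qed simp

lemma prod_list_block_labels:
  "(\<Prod>k\<leftarrow>block_labels \<alpha> ks. g k) = (\<Prod>k\<leftarrow>ks. g k ^ \<alpha> k)"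
  by (induction ks) (simp_all add: block_labels_def prod_list_replicate)

lemma node_differences_block_labels:
  fixes x :: "nat \<Rightarrow> 'b::comm_ring_1"
  shows "node_differences x (block_labels \<alpha> [1..<n + 1]) =
    (\<Prod>(i, j)\<in>{(i, j). 1 \<le> i \<and> i < j \<and> j \<le> n}. (x j - x i) ^ (\<alpha> i * \<alpha> j))"
proof (induction n)
  case 0
  have "{(i, j). 1 \<le> i \<and> i < j \<and> j \<le> (0::nat)} = {}" by auto
  then have "(\<Prod>(i, j)\<in>{(i, j). 1 \<le> i \<and> i < j \<and> j \<le> (0::nat)}. (x j - x i) ^ (\<alpha> i * \<alpha> j)) = 1"
    by (simp only: prod.empty)
  then show ?case by (simp add: node_differences_def block_labels_def)
next
  case (Suc n)
  define S where "S = (\<lambda>n::nat. {(i, j). 1 \<le> i \<and> i < j \<and> j \<le> n})"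
  define ls where "ls = block_labels \<alpha> [1..<n + 1]"
  have "Suc n \<notin> set ls"
    using set_block_labels[of \<alpha> "[1..<n + 1]"] by (auto simp: ls_def)
  moreover have "block_labels \<alpha> [1..<Suc n + 1] = ls @ replicate (\<alpha> (Suc n)) (Suc n)"
    by (simp add: block_labels_def ls_def)
  ultimately have "node_differences x (block_labels \<alpha> [1..<Suc n + 1]) =
      node_differences x ls * (\<Prod>k\<leftarrow>ls. x (Suc n) - x k) ^ \<alpha> (Suc n)"
    using node_differences_append_replicate by metis
  \<comment> \<open>The exponent \<alpha> i comes from the repetitions of \<open>i\<close> in
    \<open>ls\<close>, the other one from the new rows.\<close>
  also have "(\<Prod>k\<leftarrow>ls. x (Suc n) - x k) ^ \<alpha> (Suc n) =
      (\<Prod>i\<in>{1..n}. (x (Suc n) - x i) ^ (\<alpha> i * \<alpha> (Suc n)))"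
    by (simp add: ls_def prod_list_block_labels prod.distinct_set_conv_list[symmetric]
        atLeastLessThanSuc_atLeastAtMost prod_power_distrib power_mult del: upt_Suc)
  also have "\<dots> = (\<Prod>(i, j)\<in>(\<lambda>i. (i, Suc n)) ` {1..n}. (x j - x i) ^ (\<alpha> i * \<alpha> j))"
    by (simp add: prod.reindex inj_on_def)
  also have "node_differences x ls * \<dots> =
      (\<Prod>(i, j)\<in>S n \<union> (\<lambda>i. (i, Suc n)) ` {1..n}. (x j - x i) ^ (\<alpha> i * \<alpha> j))"
  proof (subst prod.union_disjoint)
    show "finite (S n)"
      by (rule finite_subset[of _ "{1..n} \<times> {1..n}"]) (auto simp: S_def)
  qed (use Suc in \<open>auto simp: S_def ls_def\<close>)
  also have "S n \<union> (\<lambda>i. (i, Suc n)) ` {1..n} = S (Suc n)"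
    by (auto simp: S_def)
  finally show ?case by (simp add: S_def)
qed

section \<open>The power series factor\<close>

text \<open>This is \<open>\<Sum>\<^sub>b (x + y)\<^sup>b t\<^sup>b = 1 / (1 - t x - t y)\<close>, compared at \<open>y\<^sup>a\<close>.\<close>

lemma geometric_power_mult_coeff_linear:
  fixes x :: "'b::comm_ring_1"
  shows "(1 - fps_X * fps_const x) ^ (a + 1) * Abs_fps (\<lambda>b. coeff ([:x, 1:] ^ b) a) = fps_X ^ a"
proof (induction a)
  case 0
  show ?case
  proof (rule fps_ext)
    fix b show "fps_nth ((1 - fps_X * fps_const x) ^ (0 + 1) *
        Abs_fps (\<lambda>b. coeff ([:x, 1:] ^ b) 0)) b = fps_nth (fps_X ^ 0) b"
      by (cases b) (simp_all add: left_diff_distrib mult.assoc fps_X_mult_nth)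
  qed
next
  case (Suc a)
  let ?D = "1 - fps_X * fps_const x" and ?G = "\<lambda>a. Abs_fps (\<lambda>b. coeff ([:x, 1:] ^ b) a)"
  \<comment> \<open>This is Pascal's rule: compare (x + y)^(b+1) = (x + y) (x + y)^b at
    y^(a+1).\<close>
  have "?D * ?G (Suc a) = fps_X * ?G a"
  proof (rule fps_ext)
    fix b show "fps_nth (?D * ?G (Suc a)) b = fps_nth (fps_X * ?G a) b"
      by (cases b) (simp_all add: left_diff_distrib mult.assoc fps_X_mult_nth)
  qed
  then have "?D ^ (a + 1) * (?D * ?G (Suc a)) = fps_X * (?D ^ (a + 1) * ?G a)"
    by (simp only: mult.left_commute)
  also have "?D ^ (a + 1) * (?D * ?G (Suc a)) = ?D ^ (Suc a + 1) * ?G (Suc a)"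
    by (simp only: power_Suc2 mult.assoc add_Suc)
  finally show ?case by (simp only: Suc power_Suc)
qed

lemma M_block_index:
  fixes F :: "'b::comm_ring_1 fps"
  assumes "a < \<alpha>" "b < m"
  shows "M_block F \<alpha> m x $$ (a, b) =
    (\<Sum>c\<le>b. coeff ([:x, 1:] ^ c) a * fps_nth F (b - c))"
proof -
  define D where "D = (1 - fps_X * fps_const x) ^ (a + 1)"
  define G where "G = Abs_fps (\<lambda>b. coeff ([:x, 1:] ^ b) a)"
  define Q where "Q = fps_quot F D"
  have "fps_nth D 0 = 1"
    by (simp add: D_def fps_nth_power_0)
  then have "D * Q = F"
    using fps_quot_unique Q_def by blast
  moreover have "D * G = fps_X ^ a"
    unfolding D_def G_def by (rule geometric_power_mult_coeff_linear)
  \<comment> \<open>Expand t^a as \<open>D * G\<close> and absorb \<open>D\<close> into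
    \<open>Q\<close>.\<close>
  ultimately have XQ: "fps_X ^ a * Q = G * F"
    by (metis mult.assoc mult.commute)
  \<comment> \<open>Since j - i = b - a, multiplying by t^a turns the convention for negative
    indices into ordinary vanishing below t^a.\<close>
  have "M_block F \<alpha> m x $$ (a, b) = fps_nth (fps_X ^ a * Q) b"
    using assms
    by (auto simp: M_block_def Let_def fps_coeff_int_def Q_def D_def fps_X_power_mult_nth nat_diff_distrib')
  also have "\<dots> = (\<Sum>c\<le>b. coeff ([:x, 1:] ^ c) a * fps_nth F (b - c))"
    by (simp add: XQ fps_mult_nth G_def atMost_atLeast0)
  finally show ?thesis .
qed

theorem det_stack_M_blocks:
  fixes F :: "'b::comm_ring_1 fps"
  assumes F: "fps_nth F 0 = 1" and "distinct ks" and m: "m = (\<Sum>k\<leftarrow>ks. \<alpha> k)"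
  shows "det (stack_rows m (map (\<lambda>k. M_block F (\<alpha> k) m (x k)) ks)) =
    node_differences x (block_labels \<alpha> ks)"
proof -
  define ls where "ls = block_labels \<alpha> ks"
  define V where "V = confluent_vandermonde x ls"
  define T where "T = mat m m (\<lambda>(c, b). if c \<le> b then fps_nth F (b - c) else 0)"
  have len: "length ls = m" by (simp add: ls_def length_block_labels m)
  have V: "V \<in> carrier_mat m m" and T: "T \<in> carrier_mat m m"
    by (simp_all add: V_def T_def confluent_vandermonde_def len)
  \<comment> \<open>The local row index stays inside its block, as \<open>M_block_index\<close>
    requires.\<close>
  have less: "count_list (take r ls) (ls ! r) < \<alpha> (ls ! r)" if "r < m" for r
  proof -
    have "count_list (take r ls) (ls ! r) < count_list ls (ls ! r)"
      using that len by (subst (3) id_take_nth_drop[of r ls]) auto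
    also have "\<dots> \<le> \<alpha> (ls ! r)"
      unfolding ls_def by (rule count_list_block_labels_le[OF \<open>distinct ks\<close>])
    finally show ?thesis .
  qed
  have "stack_rows m (map (\<lambda>k. M_block F (\<alpha> k) m (x k)) ks) =
      mat m m (\<lambda>(r, b). M_block F (\<alpha> (ls ! r)) m (x (ls ! r)) $$
        (count_list (take r ls) (ls ! r), b))"
    using stack_rows_index[OF \<open>distinct ks\<close>, of "\<lambda>k. M_block F (\<alpha> k) m (x k)" \<alpha> m] len
    by (simp add: M_block_def ls_def)
  also have "\<dots> = V * T"
  proof (rule eq_matI)
    fix r b assume "r < dim_row (V * T)" "b < dim_col (V * T)"
    then have rb: "r < m" "b < m" using V T by auto
    let ?v = "\<lambda>c. coeff ([:x (ls ! r), 1:] ^ c) (count_list (take r ls) (ls ! r))"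
    have "(V * T) $$ (r, b) = (\<Sum>c<m. ?v c * (if c \<le> b then fps_nth F (b - c) else 0))"
      using rb V T
      by (simp add: scalar_prod_def lessThan_atLeast0)
         (simp add: V_def T_def confluent_vandermonde_def len)
    also have "\<dots> = (\<Sum>c\<le>b. ?v c * fps_nth F (b - c))"
      using rb by (intro sum.mono_neutral_cong_right) auto
    finally show "mat m m (\<lambda>(r, b). M_block F (\<alpha> (ls ! r)) m (x (ls ! r)) $$
        (count_list (take r ls) (ls ! r), b)) $$ (r, b) = (V * T) $$ (r, b)"
      using rb by (simp add: M_block_index less)
  qed (use V T in auto)
  moreover have "det T = 1"
    by (rule det_upper_unitriangular[OF T]) (simp_all add: T_def F)
  ultimately show ?thesis
    using det_mult[OF V T] by (simp add: V_def ls_def det_confluent_vandermonde)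
qed

theorem theoremA1:
  fixes f :: "'a::comm_ring_1 fps" and n m :: nat and \<alpha> :: "nat \<Rightarrow> nat"
  assumes "fps_nth f 0 = 1"
    and "\<forall>i\<in>{1..n}. \<alpha> i \<ge> 1"
    and "m = (\<Sum>i=1..n. \<alpha> i)"
  shows "det (stack_rows m (map (\<lambda>k. M_block (mconst_fps f) (\<alpha> k) m (indet k)) [1..<n + 1])) =
    (\<Prod>(i, j)\<in>{(i, j). 1 \<le> i \<and> i < j \<and> j \<le> n}. (indet j - indet i :: 'a mpoly) ^ (\<alpha> i * \<alpha> j))"
proof -
  have "fps_nth (mconst_fps f) 0 = 1"
    using assms(1) by (simp add: mconst_fps_def mconst_def)
  moreover have "m = (\<Sum>k\<leftarrow>[1..<n + 1]. \<alpha> k)"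
    by (simp add: assms(3) sum.distinct_set_conv_list[symmetric]
        atLeastLessThanSuc_atLeastAtMost del: upt_Suc)
  ultimately show ?thesis
    by (simp only: det_stack_M_blocks distinct_upt node_differences_block_labels)
qed

end
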